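(* Let $\Omega\subset\mathbb{R}^2$, the boundary curve $\varphi$, and the numbers $\bar s_0<\bar s_1=0<\bar s_2$ and $\delta>0$ be as in the context. Let $\nu>0$ and $\alpha_1,\alpha_2>0$ be arbitrary. Then there is no velocity field $u=(u_1,u_2)$ and pressure $p$ such that all of the following hold: (i) $u$ is a parallel laminar flow near $\bigcup_{s\in[\bar s_0,\bar s_2]}\varphi(s)$ (as defined in the context); (ii) for all sufficiently small $x_2>0$, $$u_1(0,x_2)=\alpha_1x_2-\frac{\alpha_2}{2}x_2^2\quad\text{and}\quad u_2(0,x_2)=0;$$ (iii) near $\bigcup_{s\in[\bar s_1,\bar s_2]}\varphi(s)$ (that is, in the intersection of $\Omega$ with some open neighbourhood of this arc), $(u,p)$ satisfies the stationary Navier-Stokes equations $$-\nu\Delta u+(u\cdot\nabla)u=-\nabla p,\qquad \mathrm{div}\,u=0,$$ with $u=0$ on $\partial\Omega$.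
   Context: Geometry. $\Omega\subset\mathbb{R}^2$ is a bounded or unbounded domain with smooth boundary. For a nonzero vector $w=r(\cos\tilde\theta,\sin\tilde\theta)$ write $\theta(w):=\tilde\theta$. A smooth curve $\varphi:(-\infty,\infty)\to\mathbb{R}^2$ parametrizes a part of the boundary: $|\partial_s\varphi(s)|=1$, $\theta(\partial_s\varphi(s))$ is a decreasing function of $s$, and $\bigcup_{-\infty<s<\infty}\varphi(s)\subset\partial\Omega$. There are $\bar s_0<\bar s_1=0<\bar s_2$ and $\delta>0$ such that $\varphi(\bar s_0)=(0,0)$, $\theta(\partial_s\varphi(s))|_{s=\bar s_0}=0$, $|\partial_s^2\varphi(s)|$ is monotone increasing for $s\in[\bar s_0,\bar s_1]$, and $|\partial_s^2\varphi(s)|=1/\delta$ for $s\in[\bar s_1,\bar s_2]$ (so $\varphi([\bar s_1,\bar s_2])$ is an arc of a circle of radius $\delta$). Normal coordinate. For $s\in[\bar s_0,\bar s_2]$ set $\Phi(s,r):=(\partial_s\varphi(s))^{\perp}r+\varphi(s)$, where $\perp$ denotes rotation by $\pi/2$ in the upward direction (so $(1,0)^\perp=(0,1)$). The domain lies on this side of the curve: $\Phi(s,r)\in\Omega$ for small $r>0$. In particular $\Phi(\bar s_0,x_2)=(0,x_2)$. Velocity fields. The velocity field $u$ is smooth, divergence free in $\Omega$ and vanishes on $\partial\Omega$. There is no stagnation point near the boundary: $u\neq0$ in $\Omega$ near $\bigcup_{\bar s_0<s<\bar s_2}\varphi(s)$. The flow is to the rightward direction: $0<\left\langle\partial_s\varphi(s),\frac{u}{|u|}(\Phi(s,r))\right\rangle\le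 1$ for $s\in[\bar s_0,\bar s_2]$ and sufficiently small $r>0$. Normalized streamline. For $a\in\Omega$ near $\bigcup_{\bar s_0<s<\bar s_2}\varphi(s)$, $\gamma_a$ is the curve in $\Omega$ satisfying $\partial_s\gamma_a(s)=\left(\frac{u}{|u|}\right)(\gamma_a(s))$, $\gamma_a(0)=a$. Poincaré map. For fixed $s$ and $s_1$ in $[\bar s_0,\bar s_2]$ sufficiently close to each other (with $s<s_1$), let $s_{min}$ be the minimum of $s'>0$ for which there exists $\tau=\tau(s')$ such that $\Phi(s_1,\tau(s'))=\gamma_{\Phi(s,r)}(s')$. Put $L(r)=L_{s,s_1}(r)=\tau(s_{min})$. Parallel laminar flow. The velocity $u$ near the boundary $\bigcup_{s'\in[\bar s_0,\bar s_2]}\varphi(s')$ is called a parallel laminar flow iff $L(r)/r=1$ near the boundary (for all such $s,s_1$ and all sufficiently small $r>0$). *)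

theory Defs
  imports "HOL-Analysis.Analysis"
begin

text \<open>Differential operators on \<open>\<real>\<^sup>n\<close>; they are only used at interior points of the regions concerned.\<close>

definition partial :: "'n::finite \<Rightarrow> (real^'n \<Rightarrow> 'b::real_normed_vector) \<Rightarrow> real^'n \<Rightarrow> 'b" where
  "partial i f x = frechet_derivative f (at x) (axis i 1)"

definition grad :: "(real^'n::finite \<Rightarrow> real) \<Rightarrow> real^'n \<Rightarrow> real^'n" where
  "grad p x = (\<chi> i. partial i p x)"

definition div_field :: "(real^'n::finite \<Rightarrow> real^'n) \<Rightarrow> real^'n \<Rightarrow> real" where
  "div_field u x = (\<Sum>i\<in>UNIV. partial i (\<lambda>y. u y $ i) x)"

definition laplacian :: "(real^'n::finite \<Rightarrow> real^'n) \<Rightarrow> real^'n \<Rightarrow> real^'n" where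
  "laplacian u x = (\<Sum>i\<in>UNIV. partial i (partial i u) x)"

definition convection :: "(real^'n::finite \<Rightarrow> real^'n) \<Rightarrow> real^'n \<Rightarrow> real^'n" where
  "convection u x = (\<Sum>i\<in>UNIV. (u x $ i) *\<^sub>R partial i u x)"

fun Ck_on :: "nat \<Rightarrow> 'a::euclidean_space set \<Rightarrow> ('a \<Rightarrow> 'b::real_normed_vector) \<Rightarrow> bool" where
  "Ck_on 0 U f = continuous_on U f"
| "Ck_on (Suc k) U f =
     ((\<forall>x\<in>U. f differentiable (at x)) \<and>
      (\<forall>b\<in>Basis. Ck_on k U (\<lambda>x. frechet_derivative f (at x) b)))"

text \<open>\<open>C\<^sup>\<infinity>\<close> on an open set; for \<open>'a = real\<close> this is smoothness of a curve.\<close>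

definition smooth_on :: "'a::euclidean_space set \<Rightarrow> ('a \<Rightarrow> 'b::real_normed_vector) \<Rightarrow> bool" where
  "smooth_on U f \<longleftrightarrow> (\<forall>k. Ck_on k U f)"

text \<open>A domain is locally the sublevel set of a smooth function without critical points.
  By the implicit function theorem its boundary is then locally a smooth curve,
  with the domain on one side.\<close>

definition smooth_domain :: "(real^2) set \<Rightarrow> bool" where
  "smooth_domain \<Omega> \<longleftrightarrow>
     open \<Omega> \<and> connected \<Omega> \<and> \<Omega> \<noteq> {} \<and>
     (\<forall>x\<in>frontier \<Omega>. \<exists>U g. open U \<and> x \<in> U \<and> smooth_on U g \<and>
        (\<forall>y\<in>U. grad g y \<noteq> 0) \<and> \<Omega> \<inter> U = {y\<in>U. g y < 0})"

definition tangent :: "(real \<Rightarrow> real^2) \<Rightarrow> real \<Rightarrow> real^2" where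
  "tangent \<phi> s = vector_derivative \<phi> (at s)"

definition curvature_vec :: "(real \<Rightarrow> real^2) \<Rightarrow> real \<Rightarrow> real^2" where
  "curvature_vec \<phi> s = vector_derivative (tangent \<phi>) (at s)"

text \<open>Rotation by \<open>\<pi>/2\<close> counterclockwise: \<open>(1,0)\<close> goes to \<open>(0,1)\<close>.\<close>

definition perp :: "real^2 \<Rightarrow> real^2" where
  "perp w = vector [- (w $ 2), w $ 1]"

definition normal_coord :: "(real \<Rightarrow> real^2) \<Rightarrow> real \<Rightarrow> real \<Rightarrow> real^2" where
  "normal_coord \<phi> s r = r *\<^sub>R perp (tangent \<phi> s) + \<phi> s"

text \<open>The angle of the tangent is taken along its continuous determination \<open>\<theta>\<close>,
  normalised by \<open>\<theta> s0 = 0\<close>.  Monotonicity is meant in the non-strict sense.\<close>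

definition boundary_setting ::
    "(real^2) set \<Rightarrow> (real \<Rightarrow> real^2) \<Rightarrow> real \<Rightarrow> real \<Rightarrow> real \<Rightarrow> real \<Rightarrow> bool" where
  "boundary_setting \<Omega> \<phi> s0 s1 s2 \<delta> \<longleftrightarrow>
     smooth_domain \<Omega> \<and>
     smooth_on UNIV \<phi> \<and>
     (\<forall>s. norm (tangent \<phi> s) = 1) \<and>
     range \<phi> \<subseteq> frontier \<Omega> \<and>
     s0 < s1 \<and> s1 = 0 \<and> s1 < s2 \<and> 0 < \<delta> \<and>
     \<phi> s0 = 0 \<and>
     (\<exists>\<theta> :: real \<Rightarrow> real. continuous_on UNIV \<theta> \<and>
        (\<forall>s. tangent \<phi> s = vector [cos (\<theta> s), sin (\<theta> s)]) \<and>
        antimono \<theta> \<and> \<theta> s0 = 0) \<and>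
     mono_on {s0..s1} (\<lambda>s. norm (curvature_vec \<phi> s)) \<and>
     (\<forall>s\<in>{s1..s2}. norm (curvature_vec \<phi> s) = 1 / \<delta>) \<and>
     (\<exists>r0>0. \<forall>s\<in>{s0..s2}. \<forall>r\<in>{0<..<r0}. normal_coord \<phi> s r \<in> \<Omega>)"

text \<open>Smoothness is required inside the domain only; continuity up to the boundary gives
  meaning to the boundary values.\<close>

definition velocity_field ::
    "(real^2) set \<Rightarrow> (real \<Rightarrow> real^2) \<Rightarrow> real \<Rightarrow> real \<Rightarrow> (real^2 \<Rightarrow> real^2) \<Rightarrow> bool" where
  "velocity_field \<Omega> \<phi> s0 s2 u \<longleftrightarrow>
     smooth_on \<Omega> u \<and> continuous_on (closure \<Omega>) u \<and>
     (\<forall>x\<in>\<Omega>. div_field u x = 0) \<and>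
     (\<forall>x\<in>frontier \<Omega>. u x = 0) \<and>
     (\<exists>N. open N \<and> \<phi> ` {s0<..<s2} \<subseteq> N \<and> (\<forall>x\<in>\<Omega> \<inter> N. u x \<noteq> 0)) \<and>
     (\<exists>r0>0. \<forall>s\<in>{s0..s2}. \<forall>r\<in>{0<..<r0}.
        let x = normal_coord \<phi> s r; c = tangent \<phi> s \<bullet> (u x /\<^sub>R norm (u x))
        in 0 < c \<and> c \<le> 1)"

text \<open>\<open>\<gamma>\<close> is the normalised streamline through \<open>a\<close>, followed up to time \<open>T\<close>.
  The field \<open>u / |u|\<close> only makes sense where \<open>u \<noteq> 0\<close>.\<close>

definition streamline ::
    "(real^2) set \<Rightarrow> (real^2 \<Rightarrow> real^2) \<Rightarrow> real^2 \<Rightarrow> real \<Rightarrow> (real \<Rightarrow> real^2) \<Rightarrow> bool" where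
  "streamline \<Omega> u a T \<gamma> \<longleftrightarrow>
     \<gamma> 0 = a \<and>
     (\<forall>t\<in>{0..T}. \<gamma> t \<in> \<Omega> \<and> u (\<gamma> t) \<noteq> 0 \<and>
        (\<gamma> has_vector_derivative (u (\<gamma> t) /\<^sub>R norm (u (\<gamma> t)))) (at t within {0..T}))"

text \<open>The Poincare map as a relation: \<open>L\<^sub>s\<^sub>,\<^sub>s\<^sub>'(r)\<close> is defined and equal to \<open>l\<close>.  The number
  \<open>s_min\<close> is the first positive time at which the streamline starting at \<open>\<Phi>(s,r)\<close>
  meets the normal line at \<open>s'\<close>.\<close>

definition poincare_value ::
    "(real^2) set \<Rightarrow> (real \<Rightarrow> real^2) \<Rightarrow> (real^2 \<Rightarrow> real^2) \<Rightarrow> real \<Rightarrow> real \<Rightarrow> real \<Rightarrow> real \<Rightarrow> bool" where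
  "poincare_value \<Omega> \<phi> u s s' r l \<longleftrightarrow>
     (\<exists>s_min>0. \<exists>\<gamma>. streamline \<Omega> u (normal_coord \<phi> s r) s_min \<gamma> \<and>
        normal_coord \<phi> s' l = \<gamma> s_min \<and>
        (\<forall>t\<in>{0<..<s_min}. \<nexists>\<tau>. normal_coord \<phi> s' \<tau> = \<gamma> t))"

definition parallel_laminar ::
    "(real^2) set \<Rightarrow> (real \<Rightarrow> real^2) \<Rightarrow> real \<Rightarrow> real \<Rightarrow> (real^2 \<Rightarrow> real^2) \<Rightarrow> bool" where
  "parallel_laminar \<Omega> \<phi> s0 s2 u \<longleftrightarrow>
     (\<exists>\<eta>>0. \<exists>r0>0. \<forall>s\<in>{s0..s2}. \<forall>s'\<in>{s0..s2}. \<forall>r\<in>{0<..<r0}.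
        s < s' \<and> s' - s < \<eta> \<longrightarrow>
        (\<exists>l. poincare_value \<Omega> \<phi> u s s' r l \<and> l / r = 1))"

text \<open>Stationary Navier-Stokes equations in the part of the domain near the set \<open>A\<close>.\<close>

definition stationary_NS_near ::
    "(real^2) set \<Rightarrow> (real^2) set \<Rightarrow> real \<Rightarrow> (real^2 \<Rightarrow> real^2) \<Rightarrow> (real^2 \<Rightarrow> real) \<Rightarrow> bool" where
  "stationary_NS_near \<Omega> A \<nu> u p \<longleftrightarrow>
     (\<exists>N. open N \<and> A \<subseteq> N \<and>
        (\<forall>x\<in>\<Omega> \<inter> N. p differentiable (at x) \<and>
           - \<nu> *\<^sub>R laplacian u x + convection u x = - grad p x \<and>
           div_field u x = 0)) \<and>
     (\<forall>x\<in>frontier \<Omega>. u x = 0)"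

end

theory Submission
  imports Defs
begin

text \<open>In the normal coordinates \<open>(s,r)\<close> the streamlines of a parallel laminar flow are the curves
  \<open>r = const\<close>, so \<open>u = f(s,r) \<tau>(s)\<close>, and incompressibility forces \<open>f\<close> to be independent of \<open>s\<close>. Hence
  \<open>f(r) = \<alpha>\<^sub>1 r - \<alpha>\<^sub>2 r\<^sup>2 / 2\<close>, and along the circular arc the flow is a rotation around the centre, with
  speed \<open>f(\<rho> - \<delta>)\<close> at distance \<open>\<rho>\<close>. There the radial derivative of the pressure depends on \<open>r\<close> only,
  whence \<open>p(s,r) - p(s',r)\<close> is independent of \<open>r\<close>; on the other hand it equals \<open>(s - s') h(r)\<close>, where
  \<open>h(r)\<close> is, up to the factor \<open>- \<nu> / \<delta>\<close>, equal to \<open>3 \<alpha>\<^sub>2 \<rho> / 2 + C / \<rho>\<close> with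
  \<open>C = - (\<alpha>\<^sub>1 \<delta> + \<alpha>\<^sub>2 \<delta>\<^sup>2 / 2) < 0\<close>, which is strictly increasing.\<close>

section \<open>Plane vectors and unit-speed curves\<close>

lemma perp_nth [simp]: "perp w $ 1 = - (w $ 2)" "perp w $ 2 = w $ 1"
  by (simp_all add: perp_def)

lemma inner_vec2: "(x::real^2) \<bullet> y = x $ 1 * y $ 1 + x $ 2 * y $ 2"
  by (simp add: inner_vec_def sum_2)

lemma bounded_linear_perp: "bounded_linear perp"
  by (rule linear_conv_bounded_linear[THEN iffD1], rule linearI)
     (simp_all add: vec_eq_iff forall_2)

lemma perp_diff: "perp (x - y) = perp x - perp y"
  and perp_minus: "perp (- x) = - perp x"
  and perp_scaleR: "perp (a *\<^sub>R x) = a *\<^sub>R perp x"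
  by (simp_all add: vec_eq_iff forall_2)

lemma perp_perp [simp]: "perp (perp w) = - w"
  by (simp add: vec_eq_iff forall_2)

lemma inner_perp_self [simp]: "w \<bullet> perp w = 0" "perp w \<bullet> w = 0"
  by (simp_all add: inner_vec2)

lemma inner_perp_perp [simp]: "perp w \<bullet> perp z = w \<bullet> z"
  by (simp add: inner_vec2)

lemma norm_perp [simp]: "norm (perp w) = norm w"
  by (simp add: norm_eq_sqrt_inner)

lemma orthonormal_expansion:
  assumes "norm t = 1"
  shows "x = (x \<bullet> t) *\<^sub>R t + (x \<bullet> perp t) *\<^sub>R perp t"
proof -
  have t: "(t $ 1)\<^sup>2 + (t $ 2)\<^sup>2 = 1"
    using assms by (simp add: norm_eq_sqrt_inner inner_vec2 power2_eq_square)
  have "x $ 1 * ((t $ 1)\<^sup>2 + (t $ 2)\<^sup>2) = (x \<bullet> t) * t $ 1 - (x \<bullet> perp t) * t $ 2"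
       "x $ 2 * ((t $ 1)\<^sup>2 + (t $ 2)\<^sup>2) = (x \<bullet> t) * t $ 2 + (x \<bullet> perp t) * t $ 1"
    by (simp_all add: inner_vec2 algebra_simps power2_eq_square)
  then show ?thesis
    by (simp add: t vec_eq_iff forall_2)
qed

section \<open>Frenet equations and normal coordinates of a unit-speed curve\<close>

lemma smooth_onD:
  assumes "smooth_on U f" "x \<in> U"
  shows "f differentiable (at x)"
  using assms(1)[unfolded smooth_on_def, rule_format, of "Suc 0"] assms(2) by simp

lemma smooth_curve_tangent:
  assumes "smooth_on UNIV \<phi>"
  shows "(\<phi> has_vector_derivative tangent \<phi> s) (at s)"
  using smooth_onD[OF assms UNIV_I]
  by (simp add: tangent_def vector_derivative_works[symmetric])

lemma smooth_curve_curvature: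
  assumes "smooth_on UNIV \<phi>"
  shows "(tangent \<phi> has_vector_derivative curvature_vec \<phi> s) (at s)"
proof -
  have "frechet_derivative \<phi> (at x) 1 = tangent \<phi> x" for x
    using smooth_curve_tangent[OF assms, of x]
    by (auto simp: has_vector_derivative_def dest: frechet_derivative_at[symmetric])
  then have "(\<lambda>x. frechet_derivative \<phi> (at x) 1) = tangent \<phi>"
    by auto
  moreover have "(\<lambda>x. frechet_derivative \<phi> (at x) 1) differentiable (at s)"
    using assms[unfolded smooth_on_def, rule_format, of "Suc (Suc 0)"] by simp
  ultimately show ?thesis
    by (simp add: curvature_vec_def vector_derivative_works[symmetric])
qed

text \<open>This is the signed curvature, minus the rate of change of the tangent angle. With this
  sign a curve turning clockwise has nonnegative curvature, and its left normals spread
  apart.\<close>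

definition curv :: "(real \<Rightarrow> real^2) \<Rightarrow> real \<Rightarrow> real" where
  "curv \<phi> s = - (curvature_vec \<phi> s \<bullet> perp (tangent \<phi> s))"

lemma curvature_vec_eq_curv:
  assumes "smooth_on UNIV \<phi>" "\<And>s. norm (tangent \<phi> s) = 1"
  shows "curvature_vec \<phi> s = - curv \<phi> s *\<^sub>R perp (tangent \<phi> s)"
proof -
  have "((\<lambda>s. tangent \<phi> s \<bullet> tangent \<phi> s) has_vector_derivative
        tangent \<phi> s \<bullet> curvature_vec \<phi> s + curvature_vec \<phi> s \<bullet> tangent \<phi> s) (at s)"
    by (rule bounded_bilinear.has_vector_derivative[OF bounded_bilinear_inner]
        smooth_curve_curvature assms)+
  moreover have "(\<lambda>s. tangent \<phi> s \<bullet> tangent \<phi> s) = (\<lambda>s. 1)"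
    using assms(2) by (simp add: dot_square_norm)
  ultimately have "curvature_vec \<phi> s \<bullet> tangent \<phi> s = 0"
    using vector_derivative_unique_at[OF _ has_vector_derivative_const]
    by (fastforce simp: inner_commute)
  then show ?thesis
    using orthonormal_expansion[OF assms(2), of "curvature_vec \<phi> s" s]
    by (simp add: curv_def)
qed

lemma perp_tangent_has_derivative:
  assumes "smooth_on UNIV \<phi>" "\<And>s. norm (tangent \<phi> s) = 1"
  shows "((\<lambda>s. perp (tangent \<phi> s)) has_vector_derivative curv \<phi> s *\<^sub>R tangent \<phi> s) (at s)"
  using bounded_linear.has_vector_derivative[OF bounded_linear_perp smooth_curve_curvature[OF assms(1)], of s]
  by (simp add: curvature_vec_eq_curv[OF assms] perp_scaleR perp_minus)

text \<open>The parallel curve at height \<open>r\<close> keeps the tangent direction of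
  \<open>\<phi>\<close>; the factor \<open>1 + curv \<phi> s * r\<close> is its speed. It is
  positive for \<open>r > 0\<close> when the curvature is nonnegative, and it vanishes at the centre
  of curvature.\<close>

lemma normal_coord_deriv_fst:
  assumes "smooth_on UNIV \<phi>" "\<And>s. norm (tangent \<phi> s) = 1"
  shows "((\<lambda>s. normal_coord \<phi> s r) has_vector_derivative (1 + curv \<phi> s * r) *\<^sub>R tangent \<phi> s) (at s)"
  unfolding normal_coord_def
  by (rule derivative_eq_intros perp_tangent_has_derivative[OF assms] smooth_curve_tangent assms refl)+
     (simp add: algebra_simps)

lemma normal_coord_deriv_snd:
  "((\<lambda>r. normal_coord \<phi> s r) has_vector_derivative perp (tangent \<phi> s)) (at r)"
  unfolding normal_coord_def
  by (auto intro!: derivative_eq_intros)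

text \<open>The angle \<open>\<theta>\<close> is only known to be continuous, so it is not
  differentiated. Instead the component of the tangent along the fixed normal at \<open>s\<close> is
  used: it equals \<open>sin (\<theta> x - \<theta> s)\<close>, has derivative
  \<open>- curv \<phi> s\<close> at \<open>s\<close>, and is nonpositive just to the right of
  \<open>s\<close>, where the angle has dropped by less than \<open>pi\<close>.\<close>

lemma antimono_angle_curv_nonneg:
  assumes "smooth_on UNIV \<phi>" "\<And>s. norm (tangent \<phi> s) = 1"
    and "continuous_on UNIV \<theta>" "\<And>s. tangent \<phi> s = vector [cos (\<theta> s), sin (\<theta> s)]" "antimono \<theta>"
  shows "curv \<phi> s \<ge> 0"
proof -
  let ?q = "\<lambda>x. tangent \<phi> x \<bullet> perp (tangent \<phi> s)"
  have q: "?q x = sin (\<theta> x - \<theta> s)" for x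
    by (simp add: assms(4) inner_vec2 sin_diff)
  have "(?q has_vector_derivative curvature_vec \<phi> s \<bullet> perp (tangent \<phi> s)) (at s)"
    by (rule bounded_linear.has_vector_derivative[OF bounded_linear_inner_left smooth_curve_curvature[OF assms(1)]])
  then have "(?q has_real_derivative - curv \<phi> s) (at s)"
    by (simp add: has_real_derivative_iff_has_vector_derivative curv_def)
  then have "((\<lambda>x. (?q x - ?q s) / (x - s)) \<longlongrightarrow> - curv \<phi> s) (at_right s)"
    unfolding has_field_derivative_iff by (rule filterlim_mono) (auto simp: at_le)
  moreover have "eventually (\<lambda>x. (?q x - ?q s) / (x - s) \<le> 0) (at_right s)"
  proof -
    have "isCont \<theta> s" using assms(3) by (simp add: continuous_on_eq_continuous_at)
    then have "(\<theta> \<longlongrightarrow> \<theta> s) (at_right s)"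
      by (simp add: isCont_def filterlim_at_split)
    then have "eventually (\<lambda>x. dist (\<theta> x) (\<theta> s) < pi) (at_right s)"
      by (rule tendstoD) simp
    then show ?thesis using eventually_at_right_less[of s]
    proof eventually_elim
      case (elim x)
      have "\<theta> x \<le> \<theta> s" using assms(5) elim(2) by (simp add: antimonoD)
      then have "sin (\<theta> s - \<theta> x) \<ge> 0" using elim(1) by (intro sin_ge_zero) (auto simp: dist_real_def)
      then have "sin (\<theta> x - \<theta> s) \<le> 0" by (metis minus_diff_eq neg_0_le_iff_le sin_minus)
      then show ?case using elim(2) by (simp add: q divide_le_0_iff)
    qed
  qed
  ultimately show ?thesis
    using tendsto_upperbound[of _ "- curv \<phi> s" "at_right s" 0] by simp
qed

section \<open>Curves crossing a moving line\<close>

text \<open>Mean value inequality for \<open>\<gamma> t - t *\<^sub>R v\<close>. It is applied with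
  \<open>v = 0\<close> to bound the distance travelled, and with \<open>v\<close> the initial
  velocity to compare the chord with a straight motion.\<close>

lemma displacement_le:
  fixes \<gamma> :: "real \<Rightarrow> 'a::real_normed_vector"
  assumes "\<And>t. t \<in> {0..T} \<Longrightarrow> (\<gamma> has_vector_derivative \<gamma>' t) (at t within {0..T})"
    and "\<And>t. t \<in> {0..T} \<Longrightarrow> norm (\<gamma>' t - v) \<le> e" and "0 \<le> T"
  shows "norm (\<gamma> T - \<gamma> 0 - T *\<^sub>R v) \<le> e * T"
proof -
  let ?f = "\<lambda>t. \<gamma> t - t *\<^sub>R v"
  have "norm (?f T - ?f 0) \<le> e * norm (T - 0)"
  proof (rule differentiable_bound[where f = ?f and f' = "\<lambda>t x. x *\<^sub>R (\<gamma>' t - v)" and S = "{0..T}"])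
    fix t assume t: "t \<in> {0..T}"
    have "(?f has_vector_derivative \<gamma>' t - v) (at t within {0..T})"
      using assms(1)[OF t] by (auto intro!: derivative_eq_intros)
    then show "(?f has_derivative (\<lambda>x. x *\<^sub>R (\<gamma>' t - v))) (at t within {0..T})"
      by (simp add: has_vector_derivative_def)
    show "onorm (\<lambda>x. x *\<^sub>R (\<gamma>' t - v)) \<le> e"
      using assms(2)[OF t] order_trans[OF norm_ge_zero assms(2)[OF t]]
      by (intro onorm_bound) (simp_all add: mult_left_mono mult.commute[of e])
  qed (use assms(3) in auto)
  then show ?thesis using assms(3) by (simp add: algebra_simps)
qed

text \<open>A curve that starts at \<open>X s\<close>, where \<open>v\<close> is transversal to the lines orthogonal to \<open>\<tau>\<close>, crosses
  the line through \<open>X s'\<close> within a time tending to \<open>0\<close> as \<open>s'\<close> tends to \<open>s\<close>. If the first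
  crossing takes place at \<open>X s'\<close>, the chord is therefore asymptotically parallel both to \<open>v (X s)\<close>
  and to \<open>\<tau> s\<close>.\<close>

lemma direction_at_first_hits:
  fixes X \<tau> :: "real \<Rightarrow> real^2"
  assumes X: "(X has_vector_derivative c *\<^sub>R \<tau> s) (at s)" and "c > 0"
    and \<tau>1: "\<And>s. norm (\<tau> s) = 1" and \<tau>: "isCont \<tau> s"
    and v: "isCont v (X s)" "norm (v (X s)) = 1" "\<tau> s \<bullet> v (X s) > 0"
    and hit: "eventually (\<lambda>s'. \<exists>T>0. \<exists>\<gamma>. \<gamma> 0 = X s \<and> \<gamma> T = X s' \<and>
       (\<forall>t\<in>{0..T}. norm (v (\<gamma> t)) = 1 \<and> (\<gamma> has_vector_derivative v (\<gamma> t)) (at t within {0..T})) \<and>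
       (\<forall>t\<in>{0<..<T}. \<tau> s' \<bullet> (\<gamma> t - X s') \<noteq> 0)) (at_right s)"
  shows "v (X s) = \<tau> s"
proof -
  define a V c0 where "a = X s" and "V = v a" and "c0 = \<tau> s \<bullet> V"
  have V1: "norm V = 1" and c0: "c0 > 0" using v by (auto simp: V_def a_def c0_def)
  have lim\<tau>: "(\<tau> \<longlongrightarrow> \<tau> s) (at_right s)"
    using \<tau> by (simp add: isCont_def filterlim_at_split)
  have "isCont X s" using X has_vector_derivative_continuous by blast
  then have limX: "(X \<longlongrightarrow> a) (at_right s)"
    by (simp add: isCont_def filterlim_at_split a_def)
  have "((\<lambda>y. (1 / norm (y - s)) *\<^sub>R (X y - (X s + (y - s) *\<^sub>R (c *\<^sub>R \<tau> s)))) \<longlongrightarrow> 0) (at s)"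
    using X unfolding has_vector_derivative_def has_derivative_at2 by auto
  then have "((\<lambda>y. (1 / norm (y - s)) *\<^sub>R (X y - (X s + (y - s) *\<^sub>R (c *\<^sub>R \<tau> s)))) \<longlongrightarrow> 0) (at_right s)"
    by (rule filterlim_mono) (auto simp: at_le)
  then have "((\<lambda>y. (1 / norm (y - s)) *\<^sub>R (X y - (X s + (y - s) *\<^sub>R (c *\<^sub>R \<tau> s))) + c *\<^sub>R \<tau> s)
      \<longlongrightarrow> 0 + c *\<^sub>R \<tau> s) (at_right s)"
    by (intro tendsto_intros)
  moreover have "eventually (\<lambda>y. (1 / norm (y - s)) *\<^sub>R (X y - (X s + (y - s) *\<^sub>R (c *\<^sub>R \<tau> s))) + c *\<^sub>R \<tau> s
      = (1 / (y - s)) *\<^sub>R (X y - a)) (at_right s)"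
    using eventually_at_right_less[of s]
    by eventually_elim (simp add: a_def scaleR_diff_right scaleR_add_right)
  ultimately have limD: "((\<lambda>y. (1 / (y - s)) *\<^sub>R (X y - a)) \<longlongrightarrow> c *\<^sub>R \<tau> s) (at_right s)"
    by (simp add: filterlim_cong)
  \<comment> \<open>The starting point lies strictly behind the line through \<open>X y\<close>,
    because \<open>X\<close> leaves \<open>a\<close> in the direction
    \<open>\<tau> s\<close>.\<close>
  have ev_neg: "eventually (\<lambda>y. \<tau> y \<bullet> (a - X y) < 0) (at_right s)"
  proof -
    have "((\<lambda>y. \<tau> y \<bullet> ((1 / (y - s)) *\<^sub>R (X y - a))) \<longlongrightarrow> \<tau> s \<bullet> (c *\<^sub>R \<tau> s)) (at_right s)"
      by (intro tendsto_intros lim\<tau> limD)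
    moreover have "\<tau> s \<bullet> (c *\<^sub>R \<tau> s) > 0"
      using \<tau>1[of s] \<open>c > 0\<close> by (simp add: dot_square_norm)
    ultimately have "eventually (\<lambda>y. \<tau> y \<bullet> ((1 / (y - s)) *\<^sub>R (X y - a)) > 0) (at_right s)"
      by (rule order_tendstoD)
    then show ?thesis using eventually_at_right_less[of s]
      by eventually_elim (simp add: zero_less_divide_iff inner_diff_right)
  qed
  \<comment> \<open>Here \<open>\<epsilon>\<close> bounds the oscillation of \<open>v\<close> near
    \<open>a\<close>. The bound \<open>1/2\<close> makes the travel time at most twice the chord;
    the bound \<open>c0 / 2\<close> guarantees progress towards the line.\<close>
  have key: "\<bar>\<tau> s \<bullet> perp V\<bar> \<le> 2 * \<epsilon>" if \<epsilon>: "0 < \<epsilon>" "\<epsilon> < 1/2" "\<epsilon> < c0 / 2" for \<epsilon>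
  proof -
    have "isCont v a" using v by (simp add: a_def)
    then obtain d where d: "d > 0" "\<And>y. dist y a < d \<Longrightarrow> norm (v y - V) < \<epsilon>"
      using \<epsilon>(1) unfolding continuous_at_eps_delta V_def by (metis dist_norm)
    define h where "h = d / 2"
    have h: "0 < h" "h < d" using d by (auto simp: h_def)
    have "((\<lambda>y. \<tau> y \<bullet> (a - X y)) \<longlongrightarrow> \<tau> s \<bullet> (a - a)) (at_right s)"
      by (intro tendsto_intros lim\<tau> limX)
    \<comment> \<open>In time \<open>h\<close> the curve advances by at least
      \<open>(c0/2 - \<epsilon>) * h\<close> across the lines, so the line through
      \<open>X y\<close> is taken closer to \<open>a\<close> than that.\<close>
    then have ev_m: "eventually (\<lambda>y. \<tau> y \<bullet> (a - X y) > - ((c0/2 - \<epsilon>) * h)) (at_right s)"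
      using \<epsilon> h by (intro order_tendstoD) auto
    have "((\<lambda>y. \<tau> y \<bullet> V) \<longlongrightarrow> c0) (at_right s)"
      unfolding c0_def by (intro tendsto_intros lim\<tau>)
    then have ev_c: "eventually (\<lambda>y. \<tau> y \<bullet> V > c0 / 2) (at_right s)"
      using c0 by (intro order_tendstoD) auto
    have "eventually (\<lambda>y. \<bar>((1 / (y - s)) *\<^sub>R (X y - a)) \<bullet> perp V\<bar>
        \<le> 2 * \<epsilon> * norm ((1 / (y - s)) *\<^sub>R (X y - a))) (at_right s)"
      using hit ev_neg ev_m ev_c eventually_at_right_less[of s]
    proof eventually_elim
      case (elim y)
      then obtain T \<gamma> where T: "T > 0" and \<gamma>0: "\<gamma> 0 = a" and \<gamma>T: "\<gamma> T = X y"
        and \<gamma>: "\<And>t. t \<in> {0..T} \<Longrightarrow> norm (v (\<gamma> t)) = 1"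
          "\<And>t. t \<in> {0..T} \<Longrightarrow> (\<gamma> has_vector_derivative v (\<gamma> t)) (at t within {0..T})"
        and first: "\<And>t. t \<in> {0<..<T} \<Longrightarrow> \<tau> y \<bullet> (\<gamma> t - X y) \<noteq> 0"
        by (auto simp: a_def)
      have \<gamma>sub: "(\<gamma> has_vector_derivative v (\<gamma> t)) (at t within {0..t'})" if "t \<in> {0..t'}" "t' \<le> T" for t t'
        using \<gamma>(2)[of t] that by (auto intro: has_vector_derivative_within_subset)
      have speed: "norm (\<gamma> t - a) \<le> t" if "t \<in> {0..T}" for t
        using displacement_le[of t \<gamma> "\<lambda>t. v (\<gamma> t)" 0 1] that \<gamma>(1) \<gamma>sub by (simp add: \<gamma>0)
      \<comment> \<open>At unit speed the curve stays within distance \<open>h < d\<close> of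
        \<open>a\<close> up to time \<open>h\<close>, so its velocity stays
        \<open>\<epsilon>\<close>-close to \<open>V\<close>.\<close>
      have disp: "norm (\<gamma> t - a - t *\<^sub>R V) \<le> \<epsilon> * t" if "t \<in> {0..T}" "t \<le> h" for t
      proof -
        have "norm (v (\<gamma> t') - V) \<le> \<epsilon>" if "t' \<in> {0..t}" for t'
          using speed[of t'] that \<open>t \<in> _\<close> \<open>t \<le> h\<close> h by (intro less_imp_le d(2)) (auto simp: dist_norm)
        then show ?thesis
          using displacement_le[of t \<gamma> "\<lambda>t. v (\<gamma> t)" V \<epsilon>] that \<gamma>sub by (simp add: \<gamma>0)
      qed
      \<comment> \<open>Otherwise the signed distance to the line changes sign on
        \<open>{0..h}\<close>, giving a crossing before the first one.\<close>
      have "T \<le> h"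
      proof (rule ccontr)
        assume "\<not> T \<le> h"
        then have hT: "h < T" by simp
        let ?f = "\<lambda>t. \<tau> y \<bullet> (\<gamma> t - X y)"
        have "continuous_on {0..h} \<gamma>"
          using \<gamma>sub[of _ h] hT
          by (fastforce simp: continuous_on_eq_continuous_within intro: has_vector_derivative_continuous)
        then have cont: "continuous_on {0..h} ?f"
          by (intro continuous_intros)
        have "\<bar>\<tau> y \<bullet> (\<gamma> h - a - h *\<^sub>R V)\<bar> \<le> norm (\<tau> y) * norm (\<gamma> h - a - h *\<^sub>R V)"
          by (rule Cauchy_Schwarz_ineq2)
        also have "\<dots> \<le> \<epsilon> * h"
          using disp[of h] h hT by (simp add: \<tau>1)
        finally have "\<tau> y \<bullet> (\<gamma> h - a - h *\<^sub>R V) \<ge> - (\<epsilon> * h)" by simp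
        moreover have "?f h = \<tau> y \<bullet> (a - X y) + h * (\<tau> y \<bullet> V) + \<tau> y \<bullet> (\<gamma> h - a - h *\<^sub>R V)"
          by (simp add: inner_diff_right)
        moreover have "h * (\<tau> y \<bullet> V) \<ge> h * (c0 / 2)"
          using elim h by simp
        ultimately have "?f h \<ge> 0" using elim(3) by (simp add: algebra_simps)
        moreover have f0: "?f 0 < 0" using elim(2) \<gamma>0 by simp
        ultimately obtain t where t: "0 \<le> t" "t \<le> h" "?f t = 0"
          using IVT'[of ?f 0 0 h] cont h by auto
        then have "t \<noteq> 0" using f0 by auto
        then show False using first[of t] t hT by auto
      qed
      then have D: "norm (X y - a - T *\<^sub>R V) \<le> \<epsilon> * T"
        using disp[of T] T \<gamma>T by simp
      have "T = norm (T *\<^sub>R V)" using V1 T by simp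
      also have "\<dots> \<le> norm (X y - a) + norm (X y - a - T *\<^sub>R V)"
        by (metis norm_triangle_sub norm_minus_commute add.commute)
      also have "\<dots> \<le> norm (X y - a) + T / 2"
        using D mult_right_mono[of \<epsilon> "1/2" T] \<epsilon> T by linarith
      finally have T2: "T \<le> 2 * norm (X y - a)" by simp
      have "(X y - a) \<bullet> perp V = (X y - a - T *\<^sub>R V) \<bullet> perp V"
        by (simp add: inner_diff_left)
      then have "\<bar>(X y - a) \<bullet> perp V\<bar> \<le> norm (X y - a - T *\<^sub>R V) * norm (perp V)"
        by (metis Cauchy_Schwarz_ineq2)
      also have "\<dots> \<le> \<epsilon> * T" using D V1 by simp
      also have "\<dots> \<le> \<epsilon> * (2 * norm (X y - a))" using T2 \<epsilon> by simp
      finally have "\<bar>(X y - a) \<bullet> perp V\<bar> / (y - s) \<le> \<epsilon> * (2 * norm (X y - a)) / (y - s)"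
        using elim(5) by (intro divide_right_mono) auto
      then show ?case using elim(5) by (simp add: abs_divide mult_ac)
    qed
    \<comment> \<open>Divided by \<open>y - s\<close>, the chord tends to
      \<open>c *\<^sub>R \<tau> s\<close>, so the estimate passes to the limit.\<close>
    moreover have "((\<lambda>y. \<bar>((1 / (y - s)) *\<^sub>R (X y - a)) \<bullet> perp V\<bar>) \<longlongrightarrow> \<bar>(c *\<^sub>R \<tau> s) \<bullet> perp V\<bar>) (at_right s)"
      by (intro tendsto_intros limD)
    moreover have "((\<lambda>y. 2 * \<epsilon> * norm ((1 / (y - s)) *\<^sub>R (X y - a))) \<longlongrightarrow> 2 * \<epsilon> * norm (c *\<^sub>R \<tau> s)) (at_right s)"
      by (intro tendsto_intros limD)
    ultimately have "\<bar>(c *\<^sub>R \<tau> s) \<bullet> perp V\<bar> \<le> 2 * \<epsilon> * norm (c *\<^sub>R \<tau> s)"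
      by (intro tendsto_le[of "at_right s"]) auto
    then show ?thesis using \<open>c > 0\<close> \<tau>1[of s] by (simp add: abs_mult mult.commute)
  qed
  have "\<tau> s \<bullet> perp V = 0"
  proof (rule ccontr)
    assume n: "\<tau> s \<bullet> perp V \<noteq> 0"
    define \<epsilon> where "\<epsilon> = min (min (1/4) (c0 / 4)) (\<bar>\<tau> s \<bullet> perp V\<bar> / 4)"
    have "0 < \<epsilon>" "\<epsilon> < 1/2" "\<epsilon> < c0 / 2" "\<epsilon> \<le> \<bar>\<tau> s \<bullet> perp V\<bar> / 4"
      using n c0 by (auto simp: \<epsilon>_def)
    then show False using key[of \<epsilon>] n by linarith
  qed
  then have eq: "\<tau> s = c0 *\<^sub>R V"
    using orthonormal_expansion[OF V1, of "\<tau> s"] by (simp add: c0_def)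
  \<comment> \<open>Both vectors are unit and \<open>c0 > 0\<close>, hence
    \<open>c0 = 1\<close>.\<close>
  then have "norm (\<tau> s) = c0" using V1 c0 by simp
  then show ?thesis using eq \<tau>1[of s] by (simp add: V_def a_def)
qed

section \<open>Rotating flows\<close>

lemma frechet_derivative_unique:
  "(f has_derivative f') (at x) \<Longrightarrow> frechet_derivative f (at x) = f'"
  using frechet_derivative_at by force

lemma frechet_derivative_cong_eventually:
  assumes "eventually (\<lambda>y. f y = g y) (nhds x)"
  shows "frechet_derivative f (at x) = frechet_derivative g (at x)"
proof -
  have fx: "f x = g x" using assms by (rule eventually_nhds_x_imp_x)
  have "(f has_derivative f') (at x) \<longleftrightarrow> (g has_derivative f') (at x)" for f'
  proof
    assume "(f has_derivative f') (at x)"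
    then show "(g has_derivative f') (at x)"
      by (rule has_derivative_transform_eventually)
         (use assms fx in \<open>auto simp: eventually_at_filter elim: eventually_mono\<close>)
  next
    assume "(g has_derivative f') (at x)"
    then show "(f has_derivative f') (at x)"
      by (rule has_derivative_transform_eventually)
         (use assms fx in \<open>auto simp: eventually_at_filter elim: eventually_mono\<close>)
  qed
  then show ?thesis by (simp add: frechet_derivative_def)
qed

lemma partial_cong_eventually:
  assumes "eventually (\<lambda>y. f y = g y) (nhds x)"
  shows "partial i f x = partial i g x"
  unfolding partial_def by (simp add: frechet_derivative_cong_eventually[OF assms])

text \<open>For second derivatives the first derivatives must agree on a whole neighbourhood;
  \<open>eventually_eventually\<close> provides this, since nearby points also have neighbourhoods
  on which \<open>f\<close> and \<open>g\<close> agree.\<close>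

lemma laplacian_cong_eventually:
  assumes "eventually (\<lambda>y. f y = g y) (nhds x)"
  shows "laplacian f x = laplacian g x"
proof -
  have "eventually (\<lambda>y. partial i f y = partial i g y) (nhds x)" for i
    using eventually_eventually[THEN iffD2, OF assms]
    by eventually_elim (rule partial_cong_eventually)
  then show ?thesis
    unfolding laplacian_def by (intro sum.cong refl partial_cong_eventually)
qed

lemma convection_cong_eventually:
  assumes "eventually (\<lambda>y. f y = g y) (nhds x)"
  shows "convection f x = convection g x"
  unfolding convection_def
  using partial_cong_eventually[OF assms] eventually_nhds_x_imp_x[OF assms] by simp

section \<open>Derivatives of radial functions and rotating fields\<close>

lemma radial_has_derivative:
  fixes c x :: "real^2"
  assumes "(g has_real_derivative g') (at (norm (x - c)))" "x \<noteq> c"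
  shows "((\<lambda>x. g (norm (x - c))) has_derivative (\<lambda>h. g' / norm (x - c) * ((x - c) \<bullet> h))) (at x)"
proof -
  have "(norm has_derivative (\<lambda>h. sgn (x - c) \<bullet> h)) (at (x - c))"
    using has_derivative_norm[of "x - c"] assms by (simp add: inner_commute)
  moreover have "((\<lambda>x. x - c) has_derivative (\<lambda>h. h)) (at x)"
    by (auto intro!: derivative_eq_intros)
  ultimately have "((\<lambda>x. norm (x - c)) has_derivative (\<lambda>h. sgn (x - c) \<bullet> h)) (at x)"
    using has_derivative_compose by fastforce
  moreover have "(g has_derivative (*) g') (at (norm (x - c)))"
    using assms(1) by (simp add: has_field_derivative_def)
  ultimately have "((\<lambda>x. g (norm (x - c))) has_derivative (\<lambda>h. g' * (sgn (x - c) \<bullet> h))) (at x)"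
    by (rule has_derivative_compose)
  then show ?thesis
    by (rule has_derivative_eq_rhs) (simp add: fun_eq_iff sgn_div_norm divide_inverse)
qed

lemma rotating_has_derivative:
  fixes c x :: "real^2"
  assumes "(g has_real_derivative g') (at (norm (x - c)))" "x \<noteq> c"
  shows "((\<lambda>x. g (norm (x - c)) *\<^sub>R perp (x - c)) has_derivative
    (\<lambda>h. (g' / norm (x - c) * ((x - c) \<bullet> h)) *\<^sub>R perp (x - c) + g (norm (x - c)) *\<^sub>R perp h)) (at x)"
proof -
  have "((\<lambda>x. perp (x - c)) has_derivative perp) (at x)"
    by (rule bounded_linear.has_derivative[OF bounded_linear_perp, of "\<lambda>x. x - c" "\<lambda>h. h", simplified])
       (auto intro!: derivative_eq_intros)
  with radial_has_derivative[OF assms] show ?thesis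
    by (rule has_derivative_scaleR[THEN has_derivative_eq_rhs]) (simp add: fun_eq_iff)
qed

text \<open>The field is tangent to the circles around \<open>c\<close>, along which the angular
  velocity is constant. Only the factor \<open>perp (x - c)\<close> is differentiated effectively,
  and applying \<open>perp\<close> twice yields the centripetal acceleration.\<close>

lemma rotating_convection:
  fixes c x :: "real^2"
  assumes "(g has_real_derivative g') (at (norm (x - c)))" "x \<noteq> c"
  defines "u \<equiv> \<lambda>x. g (norm (x - c)) *\<^sub>R perp (x - c)"
  shows "convection u x = - ((g (norm (x - c)))\<^sup>2 *\<^sub>R (x - c))"
proof -
  let ?k = "g' / norm (x - c)" and ?g = "g (norm (x - c))"
  show ?thesis
    unfolding convection_def partial_def u_def
      frechet_derivative_unique[OF rotating_has_derivative[OF assms(1,2)]]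
    by (simp add: sum_2 vec_eq_iff forall_2 inner_vec2 axis_def power2_eq_square
        del: times_divide_eq_left times_divide_eq_right) (simp add: algebra_simps del: times_divide_eq_left times_divide_eq_right)
qed

text \<open>By the product rule, the plane Laplacian of the radial factor contributes
  \<open>g'' + g' / \<rho>\<close>. The cross term contributes \<open>2 * g' / \<rho>\<close>,
  because \<open>perp (x - c)\<close> is homogeneous of degree one.\<close>

lemma rotating_laplacian:
  fixes c x :: "real^2"
  assumes g: "\<And>\<rho>. \<rho> > 0 \<Longrightarrow> (g has_real_derivative g' \<rho>) (at \<rho>)"
    and g': "(g' has_real_derivative g'') (at (norm (x - c)))" and "x \<noteq> c"
  defines "u \<equiv> \<lambda>x. g (norm (x - c)) *\<^sub>R perp (x - c)"
  shows "laplacian u x = (g'' + 3 * g' (norm (x - c)) / norm (x - c)) *\<^sub>R perp (x - c)"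
proof -
  \<comment> \<open>The gradient of \<open>g (norm (x - c))\<close> is \<open>k\<close> times
    \<open>x - c\<close>. First partial derivatives therefore contain a rotating field with factor
    \<open>k\<close>, to which \<open>rotating_has_derivative\<close> applies again.\<close>
  define k where "k = (\<lambda>\<rho>. g' \<rho> / \<rho>)"
  define \<rho> where "\<rho> = norm (x - c)"
  have \<rho>: "\<rho> > 0" "\<rho>\<^sup>2 = (x$1 - c$1)\<^sup>2 + (x$2 - c$2)\<^sup>2"
    using \<open>x \<noteq> c\<close> unfolding \<rho>_def dot_square_norm[symmetric] inner_vec2
    by (simp_all add: power2_eq_square)
  have part: "partial i u y = (y $ i - c $ i) *\<^sub>R (k (norm (y - c)) *\<^sub>R perp (y - c))
      + g (norm (y - c)) *\<^sub>R perp (axis i 1)" if "y \<noteq> c" for i y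
  proof -
    have "(g has_real_derivative g' (norm (y - c))) (at (norm (y - c)))"
      using that by (intro g) simp
    from frechet_derivative_unique[OF rotating_has_derivative[OF this that]] show ?thesis
      unfolding partial_def u_def k_def by (simp add: inner_axis mult.commute)
  qed
  define k' where "k' = g'' / \<rho> - g' \<rho> / \<rho>\<^sup>2"
  have k': "(k has_real_derivative k') (at (norm (x - c)))"
    unfolding k_def k'_def using g' \<rho>
    by (auto intro!: derivative_eq_intros simp: \<rho>_def[symmetric] field_simps power2_eq_square)
  have gn: "((\<lambda>y. g (norm (y - c))) has_derivative (\<lambda>h. k \<rho> * ((x - c) \<bullet> h))) (at x)"
    using radial_has_derivative[OF g \<open>x \<noteq> c\<close>] \<rho>(1) by (simp add: k_def \<rho>_def)
  have "partial i (partial i u) x = 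
      k \<rho> *\<^sub>R perp (x - c) + (x $ i - c $ i) *\<^sub>R ((k' / \<rho> * (x $ i - c $ i)) *\<^sub>R perp (x - c) + k \<rho> *\<^sub>R perp (axis i 1))
      + (k \<rho> * (x $ i - c $ i)) *\<^sub>R perp (axis i 1)" for i
  proof -
    have "eventually (\<lambda>y. y \<noteq> c) (nhds x)" using \<open>x \<noteq> c\<close> by (rule t1_space_nhds)
    then have "eventually (\<lambda>y. partial i u y = (y $ i - c $ i) *\<^sub>R (k (norm (y - c)) *\<^sub>R perp (y - c))
      + g (norm (y - c)) *\<^sub>R perp (axis i 1)) (nhds x)"
      by eventually_elim (rule part)
    then have "partial i (partial i u) x = partial i (\<lambda>y. (y $ i - c $ i) *\<^sub>R (k (norm (y - c)) *\<^sub>R perp (y - c))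
      + g (norm (y - c)) *\<^sub>R perp (axis i 1)) x"
      by (rule partial_cong_eventually)
    also have "\<dots> = k \<rho> *\<^sub>R perp (x - c) + (x $ i - c $ i) *\<^sub>R ((k' / \<rho> * (x $ i - c $ i)) *\<^sub>R perp (x - c) + k \<rho> *\<^sub>R perp (axis i 1))
      + (k \<rho> * (x $ i - c $ i)) *\<^sub>R perp (axis i 1)"
    proof -
      have "((\<lambda>y. y $ i - c $ i) has_derivative (\<lambda>h. h $ i)) (at x)"
        by (auto intro!: derivative_eq_intros bounded_linear.has_derivative[OF bounded_linear_vec_nth])
      from has_derivative_add[OF has_derivative_scaleR[OF this rotating_has_derivative[OF k' \<open>x \<noteq> c\<close>]]
          has_derivative_scaleR_left[OF gn, of "perp (axis i 1)"]]
      show ?thesis unfolding partial_def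
        by (subst frechet_derivative_unique, assumption)
           (simp add: \<rho>_def[symmetric] inner_axis)
    qed
    finally show ?thesis .
  qed
  note p = this
  define m where "m = k' / \<rho>"
  have "laplacian u x = (m * ((x$1 - c$1)\<^sup>2 + (x$2 - c$2)\<^sup>2) + 4 * k \<rho>) *\<^sub>R perp (x - c)"
    unfolding laplacian_def p m_def[symmetric]
    by (simp add: sum_2 vec_eq_iff forall_2 axis_def algebra_simps power2_eq_square)
  also have "m * ((x$1 - c$1)\<^sup>2 + (x$2 - c$2)\<^sup>2) = k' * \<rho>"
    unfolding \<rho>(2)[symmetric] m_def using \<rho>(1) by (simp add: power2_eq_square)
  finally have "laplacian u x = (k' * \<rho> + 4 * k \<rho>) *\<^sub>R perp (x - c)" .
  moreover have "k' * \<rho> + 4 * k \<rho> = g'' + 3 * g' \<rho> / \<rho>"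
    using \<rho>(1) by (simp add: k'_def k_def field_simps power2_eq_square)
  ultimately show ?thesis by (simp add: \<rho>_def)
qed

section \<open>The velocity field of a parallel laminar flow\<close>

lemma zero_vector_derivative_const:
  assumes "convex S" "\<And>x. x \<in> S \<Longrightarrow> (f has_vector_derivative 0) (at x within S)" "x \<in> S" "y \<in> S"
  shows "f x = f y"
proof -
  have "(f has_derivative (\<lambda>h. 0)) (at x within S)" if "x \<in> S" for x
    using assms(2)[OF that] by (simp add: has_vector_derivative_def)
  then obtain c where "\<And>x. x \<in> S \<Longrightarrow> f x = c"
    using has_derivative_zero_constant[OF assms(1)] by metis
  then show ?thesis using assms(3,4) by simp
qed

lemma vec2_eq_axis_sum: "(h::real^2) = h $ 1 *\<^sub>R axis 1 1 + h $ 2 *\<^sub>R axis 2 1"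
  by (simp add: vec_eq_iff forall_2 axis_def)

text \<open>The divergence is the trace of the derivative, which can be computed in any orthonormal
  basis, here the tangent and normal of the boundary curve.\<close>

lemma div_field_orthonormal:
  fixes u :: "real^2 \<Rightarrow> real^2"
  assumes u: "(u has_derivative D) (at x)" and t: "norm t = 1"
  shows "div_field u x = D t \<bullet> t + D (perp t) \<bullet> perp t"
proof -
  have lin: "linear D" using u by (simp add: has_derivative_linear)
  have D: "D h = h $ 1 *\<^sub>R D (axis 1 1) + h $ 2 *\<^sub>R D (axis 2 1)" for h
    by (subst vec2_eq_axis_sum) (simp add: lin linear_add linear_scale)
  have t: "(t $ 1)\<^sup>2 + (t $ 2)\<^sup>2 = 1"
    using t by (simp add: norm_eq_sqrt_inner inner_vec2 power2_eq_square)
  have "((\<lambda>y. u y $ i) has_derivative (\<lambda>h. D h $ i)) (at x)" for i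
    using bounded_linear.has_derivative[OF bounded_linear_vec_nth u] .
  then have "partial i (\<lambda>y. u y $ i) x = D (axis i 1) $ i" for i
    unfolding partial_def by (rule frechet_derivative_unique[THEN fun_cong])
  then have "div_field u x = (D (axis 1 1) $ 1 + D (axis 2 1) $ 2) * ((t $ 1)\<^sup>2 + (t $ 2)\<^sup>2)"
    by (simp add: div_field_def sum_2 t)
  also have "\<dots> = D t \<bullet> t + D (perp t) \<bullet> perp t"
    by (subst (1 2) D) (simp add: inner_vec2 algebra_simps power2_eq_square)
  finally show ?thesis .
qed

lemma has_derivative_grad:
  fixes p :: "real^2 \<Rightarrow> real"
  assumes "p differentiable (at x)"
  shows "(p has_derivative (\<lambda>h. grad p x \<bullet> h)) (at x)"
proof -
  let ?D = "frechet_derivative p (at x)"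
  have D: "(p has_derivative ?D) (at x)"
    using assms by (simp add: frechet_derivative_works)
  then have lin: "linear ?D" by (simp add: has_derivative_linear)
  have "?D h = grad p x \<bullet> h" for h
    by (subst vec2_eq_axis_sum[of h])
       (simp add: lin linear_add linear_scale grad_def partial_def inner_vec2 mult.commute)
  then show ?thesis using D by (metis (no_types, lifting) ext)
qed

lemma boundary_settingD:
  assumes "boundary_setting \<Omega> \<phi> s0 s1 s2 \<delta>"
  shows "smooth_on UNIV \<phi>" "norm (tangent \<phi> s) = 1" "open \<Omega>" "s0 < 0" "s1 = 0" "0 < s2" "0 < \<delta>"
    "tangent \<phi> s0 = vector [1, 0]" "\<phi> s0 = 0" "0 \<le> curv \<phi> s" "s \<in> {0..s2} \<Longrightarrow> curv \<phi> s = 1 / \<delta>"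
proof -
  show 1: "smooth_on UNIV \<phi>" "\<And>s. norm (tangent \<phi> s) = 1" "open \<Omega>" "s0 < 0" "s1 = 0" "0 < s2" "0 < \<delta>" "\<phi> s0 = 0"
    using assms by (auto simp: boundary_setting_def smooth_domain_def)
  obtain \<theta> :: "real \<Rightarrow> real" where \<theta>: "continuous_on UNIV \<theta>"
      "\<And>s. tangent \<phi> s = vector [cos (\<theta> s), sin (\<theta> s)]" "antimono \<theta>" "\<theta> s0 = 0"
    using assms by (auto simp: boundary_setting_def)
  show "tangent \<phi> s0 = vector [1, 0]" by (simp add: \<theta>(2,4))
  show c: "0 \<le> curv \<phi> s"
    using antimono_angle_curv_nonneg[OF 1(1,2) \<theta>(1-3)] .
  \<comment> \<open>The setting prescribes only the absolute value of the curvature; the decreasing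
    angle fixes its sign.\<close>
  show "curv \<phi> s = 1 / \<delta>" if "s \<in> {0..s2}"
  proof -
    have "norm (curvature_vec \<phi> s) = 1 / \<delta>"
      using assms that by (auto simp: boundary_setting_def)
    then show ?thesis using c by (simp add: curvature_vec_eq_curv[OF 1(1,2)] 1(2))
  qed
qed

text \<open>The condition \<open>L(r) = r\<close> says that the streamline from height
  \<open>r\<close> first meets each nearby normal line again at height \<open>r\<close>. Letting
  \<open>s'\<close> decrease to \<open>s\<close>, \<open>direction_at_first_hits\<close> applies to
  the parallel curve and the field \<open>u / |u|\<close>. The endpoint \<open>s2\<close> is
  excluded because it has no admissible \<open>s'\<close> to its right.\<close>

lemma parallel_laminar_direction:
  assumes B: "boundary_setting \<Omega> \<phi> s0 s1 s2 \<delta>" and V: "velocity_field \<Omega> \<phi> s0 s2 u"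
    and P: "parallel_laminar \<Omega> \<phi> s0 s2 u"
  obtains R where "R > 0"
    "\<And>s r. s \<in> {s0..s2} \<Longrightarrow> r \<in> {0<..<R} \<Longrightarrow> normal_coord \<phi> s r \<in> \<Omega>"
    "\<And>s r. s \<in> {s0..<s2} \<Longrightarrow> r \<in> {0<..<R} \<Longrightarrow>
       u (normal_coord \<phi> s r) = norm (u (normal_coord \<phi> s r)) *\<^sub>R tangent \<phi> s"
proof -
  note D = boundary_settingD[OF B]
  obtain R1 where R1: "R1 > 0" "\<And>s r. s \<in> {s0..s2} \<Longrightarrow> r \<in> {0<..<R1} \<Longrightarrow> normal_coord \<phi> s r \<in> \<Omega>"
    using B by (auto simp: boundary_setting_def)
  obtain R2 where R2: "R2 > 0" "\<And>s r. s \<in> {s0..s2} \<Longrightarrow> r \<in> {0<..<R2} \<Longrightarrow>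
      tangent \<phi> s \<bullet> (u (normal_coord \<phi> s r) /\<^sub>R norm (u (normal_coord \<phi> s r))) > 0"
    using V unfolding velocity_field_def Let_def by blast
  obtain \<eta> R3 where R3: "\<eta> > 0" "R3 > 0" "\<And>s s' r. s \<in> {s0..s2} \<Longrightarrow> s' \<in> {s0..s2} \<Longrightarrow> r \<in> {0<..<R3} \<Longrightarrow>
      s < s' \<Longrightarrow> s' - s < \<eta> \<Longrightarrow> \<exists>l. poincare_value \<Omega> \<phi> u s s' r l \<and> l / r = 1"
    using P unfolding parallel_laminar_def by blast
  have main: "u (normal_coord \<phi> s r) = norm (u (normal_coord \<phi> s r)) *\<^sub>R tangent \<phi> s"
    if s: "s \<in> {s0..<s2}" and r: "0 < r" "r < R1" "r < R2" "r < R3" for s r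
  proof -
    let ?x = "normal_coord \<phi> s r"
    let ?v = "\<lambda>x. u x /\<^sub>R norm (u x)"
    have pos: "tangent \<phi> s \<bullet> ?v ?x > 0" using R2(2)[of s r] s r by simp
    then have u0: "u ?x \<noteq> 0" by auto
    have "isCont u ?x"
      using V R1(2)[of s r] s r by (auto simp: velocity_field_def intro: differentiable_imp_continuous_within smooth_onD)
    then have cont: "isCont ?v ?x" using u0 by (intro continuous_intros) auto
    have "eventually (\<lambda>s'. s' < min s2 (s + \<eta>)) (at_right s)"
      using s R3(1) by (auto simp: eventually_at_right_field intro!: exI[of _ "min s2 (s + \<eta>)"])
    then have "eventually (\<lambda>s'. \<exists>T>0. \<exists>\<gamma>. \<gamma> 0 = ?x \<and> \<gamma> T = normal_coord \<phi> s' r \<and>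
       (\<forall>t\<in>{0..T}. norm (?v (\<gamma> t)) = 1 \<and> (\<gamma> has_vector_derivative ?v (\<gamma> t)) (at t within {0..T})) \<and>
       (\<forall>t\<in>{0<..<T}. tangent \<phi> s' \<bullet> (\<gamma> t - normal_coord \<phi> s' r) \<noteq> 0)) (at_right s)"
      using eventually_at_right_less[of s]
    proof eventually_elim
      case (elim s')
      then have "poincare_value \<Omega> \<phi> u s s' r r"
        using R3(3)[of s s' r] s r by auto
      then obtain T \<gamma> where T: "T > 0" "streamline \<Omega> u ?x T \<gamma>" "normal_coord \<phi> s' r = \<gamma> T"
        and first: "\<And>t. t \<in> {0<..<T} \<Longrightarrow> \<nexists>\<tau>. normal_coord \<phi> s' \<tau> = \<gamma> t"
        unfolding poincare_value_def by blast
      \<comment> \<open>The Poincare map uses the full normal line, with \<open>\<tau>\<close>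
        ranging over all reals, so a displacement orthogonal to the tangent always lies on
        it.\<close>
      have "tangent \<phi> s' \<bullet> (\<gamma> t - normal_coord \<phi> s' r) \<noteq> 0" if "t \<in> {0<..<T}" for t
      proof
        assume 0: "tangent \<phi> s' \<bullet> (\<gamma> t - normal_coord \<phi> s' r) = 0"
        define k where "k = (\<gamma> t - normal_coord \<phi> s' r) \<bullet> perp (tangent \<phi> s')"
        have "\<gamma> t - normal_coord \<phi> s' r = k *\<^sub>R perp (tangent \<phi> s')"
          using orthonormal_expansion[OF D(2)[of s'], of "\<gamma> t - normal_coord \<phi> s' r"] 0
          by (simp add: k_def inner_commute)
        then have "normal_coord \<phi> s' (r + k) = \<gamma> t"
          by (simp add: normal_coord_def algebra_simps)
        then show False using first[OF that] by blast
      qed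
      then show ?case
        using T by (intro exI[of _ T] conjI exI[of _ \<gamma>]) (auto simp: streamline_def)
    qed
    then have "?v ?x = tangent \<phi> s"
      using D(10)[of s] r pos u0 cont
      by (intro direction_at_first_hits[where X = "\<lambda>s. normal_coord \<phi> s r", OF normal_coord_deriv_fst[OF D(1,2)] _ D(2)])
         (auto intro: has_vector_derivative_continuous smooth_curve_curvature D add_pos_nonneg)
    then have "norm (u ?x) *\<^sub>R ?v ?x = norm (u ?x) *\<^sub>R tangent \<phi> s" by simp
    then show ?thesis using u0 by simp
  qed
  show ?thesis
    by (rule that[of "min R1 (min R2 R3)"]) (use R1 R2 R3 main in auto)
qed

text \<open>In the coordinates of \<open>normal_coord\<close> the divergence of a field \<open>f(s,r) \<tau>(s)\<close> is
  \<open>\<partial>\<^sub>s f / (1 + \<kappa> r)\<close>.\<close>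

lemma parallel_laminar_speed:
  assumes B: "boundary_setting \<Omega> \<phi> s0 s1 s2 \<delta>" and V: "velocity_field \<Omega> \<phi> s0 s2 u"
    and P: "parallel_laminar \<Omega> \<phi> s0 s2 u"
  obtains R where "R > 0"
    "\<And>s r. s \<in> {s0..s2} \<Longrightarrow> r \<in> {0<..<R} \<Longrightarrow> normal_coord \<phi> s r \<in> \<Omega>"
    "\<And>s r. s \<in> {s0..<s2} \<Longrightarrow> r \<in> {0<..<R} \<Longrightarrow>
       u (normal_coord \<phi> s r) = (u (vector [0, r]) $ 1) *\<^sub>R tangent \<phi> s"
proof -
  note D = boundary_settingD[OF B]
  obtain R where R: "R > 0"
    "\<And>s r. s \<in> {s0..s2} \<Longrightarrow> r \<in> {0<..<R} \<Longrightarrow> normal_coord \<phi> s r \<in> \<Omega>"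
    and dir: "\<And>s r. s \<in> {s0..<s2} \<Longrightarrow> r \<in> {0<..<R} \<Longrightarrow>
       u (normal_coord \<phi> s r) = norm (u (normal_coord \<phi> s r)) *\<^sub>R tangent \<phi> s"
    using parallel_laminar_direction[OF assms] by blast
  have "u (normal_coord \<phi> s r) = (u (vector [0, r]) $ 1) *\<^sub>R tangent \<phi> s"
    if s: "s \<in> {s0..<s2}" and r: "r \<in> {0<..<R}" for s r
  proof -
    let ?f = "\<lambda>s. u (normal_coord \<phi> s r) \<bullet> tangent \<phi> s"
    have f': "(?f has_vector_derivative 0) (at s)" if s: "s \<in> {s0..<s2}" for s
    proof -
      let ?x = "normal_coord \<phi> s r" and ?t = "tangent \<phi> s"
      obtain D' where D': "(u has_derivative D') (at ?x)"
        using V R(2)[of s r] s r smooth_onD[of \<Omega> u ?x] by (auto simp: velocity_field_def differentiable_def)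
      then have lin: "linear D'" by (simp add: has_derivative_linear)
      have "((\<lambda>r. u (normal_coord \<phi> s r)) has_vector_derivative D' (perp ?t)) (at r)"
        using has_derivative_compose[OF normal_coord_deriv_snd[unfolded has_vector_derivative_def] D']
        by (simp add: has_vector_derivative_def lin linear_scale)
      then have "((\<lambda>r. u (normal_coord \<phi> s r) \<bullet> perp ?t) has_vector_derivative D' (perp ?t) \<bullet> perp ?t) (at r)"
        by (rule bounded_linear.has_vector_derivative[OF bounded_linear_inner_left])
      moreover have "u (normal_coord \<phi> s y) \<bullet> perp ?t = 0" if "y \<in> {0<..<R}" for y
        by (subst dir[OF s that]) simp
      \<comment> \<open>The normal component of \<open>u\<close> along the fixed normal vanishes for
        all small heights, hence so does its derivative. Incompressibility then removes the
        tangential part of the trace.\<close>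
      ultimately have "((\<lambda>r. 0) has_vector_derivative D' (perp ?t) \<bullet> perp ?t) (at r)"
        using r by (elim has_vector_derivative_transform_within_open[where S = "{0<..<R}"]) auto
      then have "D' (perp ?t) \<bullet> perp ?t = 0"
        using vector_derivative_unique_at has_vector_derivative_const by blast
      moreover have "div_field u ?x = 0" using V R(2)[of s r] s r by (simp add: velocity_field_def)
      ultimately have D't: "D' ?t \<bullet> ?t = 0" using div_field_orthonormal[OF D' D(2)[of s]] by simp
      have "((\<lambda>s. u (normal_coord \<phi> s r)) has_vector_derivative (1 + curv \<phi> s * r) *\<^sub>R D' ?t) (at s)"
        using has_derivative_compose[OF normal_coord_deriv_fst[OF D(1,2), unfolded has_vector_derivative_def] D']
        by (simp add: has_vector_derivative_def lin linear_scale)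
      from bounded_bilinear.has_vector_derivative[OF bounded_bilinear_inner this smooth_curve_curvature[OF D(1)]]
      have "(?f has_vector_derivative u ?x \<bullet> curvature_vec \<phi> s + (1 + curv \<phi> s * r) * (D' ?t \<bullet> ?t)) (at s)"
        by simp
      \<comment> \<open>The velocity is tangential while the curvature vector is normal, so turning
        of the frame does not change the speed.\<close>
      moreover have "u ?x \<bullet> curvature_vec \<phi> s = 0"
        by (subst dir[OF s r]) (simp add: curvature_vec_eq_curv[OF D(1,2)])
      ultimately show ?thesis by (simp add: D't)
    qed
    have "?f s = ?f s0"
      by (rule zero_vector_derivative_const[of "{s0..<s2}"])
         (use f' s D in \<open>auto intro: has_vector_derivative_at_within\<close>)
    \<comment> \<open>At \<open>s0\<close> the curve passes through the origin horizontally, so its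
      normal line is the vertical axis.\<close>
    also have "\<dots> = u (vector [0, r]) $ 1"
    proof -
      have "normal_coord \<phi> s0 r = vector [0, r]"
        by (simp add: normal_coord_def D vec_eq_iff forall_2)
      then show ?thesis by (simp add: D(8) inner_vec2)
    qed
    finally have "?f s = u (vector [0, r]) $ 1" .
    moreover have "?f s = norm (u (normal_coord \<phi> s r))"
      by (subst dir[OF s r]) (simp add: dot_square_norm D(2))
    ultimately show ?thesis using dir[OF s r] by simp
  qed
  then show ?thesis using R that by blast
qed

section \<open>Polar coordinates along the circular arc\<close>

text \<open>The tangent turns clockwise at rate \<open>k\<close>. Turning it back by the angle
  \<open>k * (x - s)\<close> gives a vector with zero derivative, and inverting this rotation gives
  the formula.\<close>

lemma constant_curvature_rotation:
  assumes "smooth_on UNIV \<phi>" "\<And>s. norm (tangent \<phi> s) = 1" "convex I"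
    and curv: "\<And>s. s \<in> I \<Longrightarrow> curv \<phi> s = k" and s: "s \<in> I" "s' \<in> I"
  shows "tangent \<phi> s' = cos (k * (s' - s)) *\<^sub>R tangent \<phi> s - sin (k * (s' - s)) *\<^sub>R perp (tangent \<phi> s)"
proof -
  let ?a = "\<lambda>x. cos (k * (x - s)) *\<^sub>R tangent \<phi> x + sin (k * (x - s)) *\<^sub>R perp (tangent \<phi> x)"
  have "(?a has_vector_derivative 0) (at x within I)" if "x \<in> I" for x
  proof -
    have "((\<lambda>x. cos (k * (x - s))) has_real_derivative - (sin (k * (x - s)) * k)) (at x)"
      "((\<lambda>x. sin (k * (x - s))) has_real_derivative cos (k * (x - s)) * k) (at x)"
      by (auto intro!: derivative_eq_intros)
    from has_vector_derivative_add[OF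
        has_vector_derivative_scaleR[OF this(1) smooth_curve_curvature[OF assms(1)]]
        has_vector_derivative_scaleR[OF this(2) perp_tangent_has_derivative[OF assms(1,2)]]]
    have "(?a has_vector_derivative 0) (at x)"
      by (simp add: curv[OF that] curvature_vec_eq_curv[OF assms(1,2)])
    then show ?thesis by (rule has_vector_derivative_at_within)
  qed
  then have "?a s' = ?a s"
    by (rule zero_vector_derivative_const[where f = ?a, OF \<open>convex I\<close> _ s(2,1)])
  then have a: "?a s' = tangent \<phi> s" by simp
  have id: "(c\<^sup>2 + d\<^sup>2) *\<^sub>R t = c *\<^sub>R (c *\<^sub>R t + d *\<^sub>R perp t) - d *\<^sub>R perp (c *\<^sub>R t + d *\<^sub>R perp t)"
    for c d :: real and t
    by (simp add: vec_eq_iff forall_2 algebra_simps power2_eq_square)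
  have "tangent \<phi> s' = ((cos (k * (s' - s)))\<^sup>2 + (sin (k * (s' - s)))\<^sup>2) *\<^sub>R tangent \<phi> s'" by simp
  also have "\<dots> = cos (k * (s' - s)) *\<^sub>R ?a s' - sin (k * (s' - s)) *\<^sub>R perp (?a s')"
    by (rule id)
  finally show ?thesis unfolding a .
qed

text \<open>The point at signed height \<open>- \<delta>\<close> is the centre of the circle: there
  the factor \<open>1 + curv \<phi> s * r\<close> vanishes.\<close>

lemma constant_curvature_center:
  assumes "smooth_on UNIV \<phi>" "\<And>s. norm (tangent \<phi> s) = 1" "convex I" "\<delta> > 0"
    and curv: "\<And>s. s \<in> I \<Longrightarrow> curv \<phi> s = 1 / \<delta>" and s: "s \<in> I" "s' \<in> I"
  shows "normal_coord \<phi> s' (- \<delta>) = normal_coord \<phi> s (- \<delta>)"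
proof (rule zero_vector_derivative_const[OF \<open>convex I\<close> _ s(2,1)])
  fix x assume "x \<in> I"
  then have "(1 + curv \<phi> x * - \<delta>) *\<^sub>R tangent \<phi> x = 0"
    using curv \<open>\<delta> > 0\<close> by simp
  then show "((\<lambda>s. normal_coord \<phi> s (- \<delta>)) has_vector_derivative 0) (at x within I)"
    using normal_coord_deriv_fst[OF assms(1,2), of "- \<delta>" x]
    by (metis has_vector_derivative_at_within)
qed

text \<open>The differential operators need \<open>u\<close> on an open set, so normal coordinates
  must cover a full neighbourhood. The foot point \<open>s'\<close> is found explicitly from the
  polar angle around the centre; the open parameter interval leaves room to move it.\<close>

lemma arc_polar_coordinates:
  assumes \<phi>: "smooth_on UNIV \<phi>" "\<And>s. norm (tangent \<phi> s) = 1" and "\<delta> > 0"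
    and curv: "\<And>s. s \<in> {a<..<b} \<Longrightarrow> curv \<phi> s = 1 / \<delta>"
    and s: "s \<in> {a<..<b}" and r: "r \<in> {0<..<R}"
  defines "c \<equiv> normal_coord \<phi> s (- \<delta>)"
  shows "eventually (\<lambda>x. \<exists>s'\<in>{a<..<b}. norm (x - c) - \<delta> \<in> {0<..<R} \<and>
      x - c = norm (x - c) *\<^sub>R perp (tangent \<phi> s') \<and>
      x = normal_coord \<phi> s' (norm (x - c) - \<delta>)) (nhds (normal_coord \<phi> s r))"
proof -
  let ?t = "tangent \<phi> s" and ?n = "perp (tangent \<phi> s)"
  define x0 where "x0 = normal_coord \<phi> s r"
  define w where "w = (\<lambda>x. x - c)"
  have w0: "w x0 = (\<delta> + r) *\<^sub>R ?n"
    by (simp add: w_def x0_def c_def normal_coord_def algebra_simps)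
  have nw0: "norm (w x0) = \<delta> + r" using w0 \<phi>(2) r \<open>\<delta> > 0\<close> by simp
  have wlim: "(w \<longlongrightarrow> w x0) (nhds x0)"
    unfolding w_def by (intro tendsto_intros filterlim_ident)
  have n: "((\<lambda>x. norm (w x)) \<longlongrightarrow> \<delta> + r) (nhds x0)"
    unfolding nw0[symmetric] by (intro tendsto_intros wlim)
  have e1: "eventually (\<lambda>x. norm (w x) > \<delta>) (nhds x0)" "eventually (\<lambda>x. norm (w x) < \<delta> + R) (nhds x0)"
    using r by (auto intro!: order_tendstoD[OF n])
  have "((\<lambda>x. w x \<bullet> ?n) \<longlongrightarrow> w x0 \<bullet> ?n) (nhds x0)"
    by (intro tendsto_intros wlim)
  then have e2: "eventually (\<lambda>x. w x \<bullet> ?n > 0) (nhds x0)"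
    by (rule order_tendstoD) (use r \<open>\<delta> > 0\<close> \<phi>(2)[of s] in \<open>simp add: w0 dot_square_norm\<close>)
  \<comment> \<open>This is the sine of the clockwise angle from the normal at \<open>s\<close> to
    \<open>w x\<close>. Since the cosine \<open>\<alpha>\<close> is positive, \<open>arcsin\<close>
    recovers the angle itself.\<close>
  define \<beta> where "\<beta> = (\<lambda>x. (w x \<bullet> ?t) / norm (w x))"
  have "(\<beta> \<longlongrightarrow> (w x0 \<bullet> ?t) / (\<delta> + r)) (nhds x0)"
    unfolding \<beta>_def using r \<open>\<delta> > 0\<close> by (intro tendsto_intros n wlim) auto
  then have \<beta>: "(\<beta> \<longlongrightarrow> 0) (nhds x0)" by (simp add: w0)
  have "((\<lambda>x. s + \<delta> * arcsin (\<beta> x)) \<longlongrightarrow> s + \<delta> * arcsin 0) (nhds x0)"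
    by (intro tendsto_intros isCont_tendsto_compose[OF _ \<beta>, of arcsin] isCont_arcsin) auto
  then have \<sigma>: "((\<lambda>x. s + \<delta> * arcsin (\<beta> x)) \<longlongrightarrow> s) (nhds x0)" by simp
  have e3: "eventually (\<lambda>x. s + \<delta> * arcsin (\<beta> x) > a) (nhds x0)" "eventually (\<lambda>x. s + \<delta> * arcsin (\<beta> x) < b) (nhds x0)"
    using s by (auto intro!: order_tendstoD[OF \<sigma>])
  show ?thesis
    unfolding x0_def[symmetric] using e1 e2 e3
  proof eventually_elim
    case (elim x)
    let ?\<sigma> = "arcsin (\<beta> x)" and ?\<rho> = "norm (w x)"
    have \<rho>: "?\<rho> > 0" using elim(1) \<open>\<delta> > 0\<close> by linarith
    define \<alpha> where "\<alpha> = (w x \<bullet> ?n) / ?\<rho>"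
    have wx: "w x = ?\<rho> *\<^sub>R (\<beta> x *\<^sub>R ?t + \<alpha> *\<^sub>R ?n)"
      using orthonormal_expansion[OF \<phi>(2)[of s], of "w x"] \<rho>
      by (simp add: \<alpha>_def \<beta>_def scaleR_add_right)
    have "(w x \<bullet> ?t)\<^sup>2 + (w x \<bullet> ?n)\<^sup>2 = w x \<bullet> ((w x \<bullet> ?t) *\<^sub>R ?t + (w x \<bullet> ?n) *\<^sub>R ?n)"
      by (simp add: inner_add_right power2_eq_square)
    also have "\<dots> = ?\<rho>\<^sup>2"
      using orthonormal_expansion[OF \<phi>(2)[of s], of "w x"] by (simp add: dot_square_norm)
    finally have sq: "(\<beta> x)\<^sup>2 + \<alpha>\<^sup>2 = 1"
      using \<rho> by (simp add: \<alpha>_def \<beta>_def power_divide add_divide_distrib[symmetric])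
    have "\<alpha> > 0" using elim \<rho> by (simp add: \<alpha>_def)
    have "(\<beta> x)\<^sup>2 \<le> 1" using sq zero_le_power2[of \<alpha>] by linarith
    then have b: "-1 \<le> \<beta> x" "\<beta> x \<le> 1" by (auto simp: abs_square_le_1 abs_le_iff)
    then have "cos ?\<sigma> = sqrt (1 - (\<beta> x)\<^sup>2)" by (rule cos_arcsin)
    also have "\<dots> = \<alpha>" using sq \<open>\<alpha> > 0\<close> by (metis add_diff_cancel_left' less_imp_le real_sqrt_unique)
    finally have cs: "cos ?\<sigma> = \<alpha>" "sin ?\<sigma> = \<beta> x" using b by auto
    define s' where "s' = s + \<delta> * ?\<sigma>"
    have s': "s' \<in> {a<..<b}" using elim by (simp add: s'_def)
    have "1 / \<delta> * (s' - s) = ?\<sigma>" using \<open>\<delta> > 0\<close> by (simp add: s'_def)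
    then have "tangent \<phi> s' = \<alpha> *\<^sub>R ?t - \<beta> x *\<^sub>R ?n"
      using constant_curvature_rotation[OF \<phi> convex_real_interval(8) curv s s'] cs by simp
    then have wn: "w x = ?\<rho> *\<^sub>R perp (tangent \<phi> s')"
      by (subst wx) (simp add: perp_diff perp_scaleR)
    have "c = normal_coord \<phi> s' (- \<delta>)"
      unfolding c_def
      using constant_curvature_center[OF \<phi> convex_real_interval(8) \<open>\<delta> > 0\<close> curv s' s] by simp
    then have "normal_coord \<phi> s' (?\<rho> - \<delta>) = c + ?\<rho> *\<^sub>R perp (tangent \<phi> s')"
      by (simp add: normal_coord_def algebra_simps)
    also have "\<dots> = x" by (simp add: wn[symmetric]) (simp add: w_def)
    finally show ?case
      using s' elim wn by (intro bexI[of _ s']) (auto simp: w_def)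
  qed
qed

section \<open>The pressure along the circular arc\<close>

text \<open>Near the point the flow is a rotation about the centre of the arc, so the momentum
  equation splits into a viscous tangential part and a centripetal normal part. The factor
  \<open>1 + r / \<delta>\<close> turns the tangential component into the derivative of the pressure
  in \<open>s\<close>.\<close>

lemma parallel_laminar_arc_pressure_gradient:
  assumes B: "boundary_setting \<Omega> \<phi> s0 s1 s2 \<delta>"
    and u: "\<And>s r. s \<in> {0<..<s2} \<Longrightarrow> r \<in> {0<..<R} \<Longrightarrow>
       u (normal_coord \<phi> s r) = (\<alpha>1 * r - \<alpha>2 / 2 * r\<^sup>2) *\<^sub>R tangent \<phi> s"
    and NS: "- \<nu> *\<^sub>R laplacian u (normal_coord \<phi> s r) + convection u (normal_coord \<phi> s r) = - grad p (normal_coord \<phi> s r)"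
    and s: "s \<in> {0<..<s2}" and r: "r \<in> {0<..<R}"
  defines "C \<equiv> - (\<alpha>1 * \<delta> + \<alpha>2 * \<delta>\<^sup>2 / 2)"
  shows "(1 + r / \<delta>) * (grad p (normal_coord \<phi> s r) \<bullet> tangent \<phi> s)
      = - \<nu> / \<delta> * (3 * \<alpha>2 / 2 * (\<delta> + r) + C / (\<delta> + r))" (is ?A)
    and "grad p (normal_coord \<phi> s r) \<bullet> perp (tangent \<phi> s) = (\<alpha>1 * r - \<alpha>2 / 2 * r\<^sup>2)\<^sup>2 / (\<delta> + r)" (is ?B)
proof -
  note D = boundary_settingD[OF B]
  define A where "A = \<alpha>1 + \<alpha>2 * \<delta>"
  define c where "c = normal_coord \<phi> s (- \<delta>)"
  \<comment> \<open>The quotient of the speed at radius \<open>\<rho>\<close> by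
    \<open>\<rho>\<close>, expanded in powers of \<open>\<rho>\<close>. The minus sign appears
    because \<open>perp\<close> of the outward radius points against the tangent.\<close>
  define g where "g = (\<lambda>\<rho>. - (A - \<alpha>2 / 2 * \<rho> + C / \<rho>))"
  define g' where "g' = (\<lambda>\<rho>. \<alpha>2 / 2 + C / \<rho>\<^sup>2)"
  define G where "G = (\<lambda>x. g (norm (x - c)) *\<^sub>R perp (x - c))"
  let ?x = "normal_coord \<phi> s r" and ?t = "tangent \<phi> s" 
  define \<rho> where "\<rho> = \<delta> + r"
  have \<rho>: "\<rho> > 0" using r D(7) by (simp add: \<rho>_def)
  have x: "?x - c = \<rho> *\<^sub>R perp ?t"
    by (simp add: c_def \<rho>_def normal_coord_def algebra_simps)
  have nx: "norm (?x - c) = \<rho>" using \<rho> by (simp add: x D(2))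
  then have xc: "?x \<noteq> c" using \<rho> by auto
  have "eventually (\<lambda>x. \<exists>s'\<in>{0<..<s2}. norm (x - c) - \<delta> \<in> {0<..<R} \<and>
      x - c = norm (x - c) *\<^sub>R perp (tangent \<phi> s') \<and>
      x = normal_coord \<phi> s' (norm (x - c) - \<delta>)) (nhds ?x)"
    unfolding c_def by (rule arc_polar_coordinates[OF D(1,2,7) _ s r]) (auto intro: D(11))
  then have ev: "eventually (\<lambda>x. u x = G x) (nhds ?x)"
  proof eventually_elim
    case (elim x)
    let ?\<rho> = "norm (x - c)"
    obtain s' where s': "s' \<in> {0<..<s2}" "?\<rho> - \<delta> \<in> {0<..<R}" "x - c = ?\<rho> *\<^sub>R perp (tangent \<phi> s')"
        "x = normal_coord \<phi> s' (?\<rho> - \<delta>)" using elim by blast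
    have \<rho>: "?\<rho> > 0" using s'(2) D(7) by auto
    have "u x = u (normal_coord \<phi> s' (?\<rho> - \<delta>))" using s'(4) by simp
    also have "\<dots> = (\<alpha>1 * (?\<rho> - \<delta>) - \<alpha>2 / 2 * (?\<rho> - \<delta>)\<^sup>2) *\<^sub>R tangent \<phi> s'"
      using s' by (intro u)
    also have "\<alpha>1 * (?\<rho> - \<delta>) - \<alpha>2 / 2 * (?\<rho> - \<delta>)\<^sup>2 = - (g ?\<rho> * ?\<rho>)"
      using \<rho> by (simp add: g_def A_def C_def field_simps power2_eq_square)
    also have "- (g ?\<rho> * ?\<rho>) *\<^sub>R tangent \<phi> s' = g ?\<rho> *\<^sub>R perp (?\<rho> *\<^sub>R perp (tangent \<phi> s'))"
      by (simp add: perp_scaleR)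
    also have "\<dots> = G x" unfolding G_def using s'(3) by simp
    finally show ?case .
  qed
  have dg: "(g has_real_derivative g' \<rho>) (at \<rho>)" if "\<rho> > 0" for \<rho>
    unfolding g_def g'_def using that
    by (auto intro!: derivative_eq_intros simp: power2_eq_square)
  have dg': "(g' has_real_derivative - (2 * C / \<rho> ^ 3)) (at \<rho>)" if "\<rho> > 0" for \<rho>
    unfolding g'_def using that
    by (auto intro!: derivative_eq_intros simp: field_simps power2_eq_square power3_eq_cube)
  have lap: "laplacian u ?x = (- (2 * C / \<rho> ^ 3) + 3 * g' \<rho> / \<rho>) *\<^sub>R perp (?x - c)"
    using laplacian_cong_eventually[OF ev] rotating_laplacian[OF dg dg'[OF \<rho>, folded nx] xc] nx by (simp add: G_def)
  have conv: "convection u ?x = - ((g \<rho>)\<^sup>2 *\<^sub>R (?x - c))"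
    using convection_cong_eventually[OF ev] rotating_convection[OF dg xc] nx \<rho> by (simp add: G_def)
  define P Q where "P = - (\<nu> * (- (2 * C / \<rho> ^ 3) + 3 * g' \<rho> / \<rho>) * \<rho>)"
    and "Q = (g \<rho>)\<^sup>2 * \<rho>"
  have "grad p ?x = \<nu> *\<^sub>R laplacian u ?x - convection u ?x"
  proof -
    have "grad p ?x = - (- \<nu> *\<^sub>R laplacian u ?x + convection u ?x)" unfolding NS by simp
    then show ?thesis by simp
  qed
  also have "\<dots> = P *\<^sub>R ?t + Q *\<^sub>R perp ?t"
    unfolding lap conv x P_def Q_def by (simp add: perp_scaleR)
  finally have gp: "grad p ?x = P *\<^sub>R ?t + Q *\<^sub>R perp ?t" .
  have "grad p ?x \<bullet> ?t = P" "grad p ?x \<bullet> perp ?t = Q"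
    unfolding gp by (simp_all add: inner_add_left dot_square_norm D(2))
  moreover have "P = - \<nu> * (3 * \<alpha>2 / 2 * \<rho> + C / \<rho>) / \<rho>"
    unfolding P_def g'_def using \<rho> by (simp add: field_simps power2_eq_square power3_eq_cube)
  moreover have "1 + r / \<delta> = \<rho> / \<delta>" using D(7) by (simp add: \<rho>_def field_simps)
  moreover have "Q = (- (g \<rho> * \<rho>))\<^sup>2 / \<rho>"
    unfolding Q_def using \<rho> by (simp add: power2_eq_square)
  moreover have "- (g \<rho> * \<rho>) = \<alpha>1 * (\<rho> - \<delta>) - \<alpha>2 / 2 * (\<rho> - \<delta>)\<^sup>2"
    using \<rho> by (simp add: g_def A_def C_def field_simps power2_eq_square)
  moreover have "\<rho> - \<delta> = r" by (simp add: \<rho>_def)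
  ultimately show ?A ?B
    unfolding \<rho>_def[symmetric] using \<rho> by (simp_all del: power2_minus)
qed

theorem theorem1p9:
  fixes \<Omega> :: "(real^2) set" and \<phi> :: "real \<Rightarrow> real^2"
    and s0 s1 s2 \<delta> \<nu> \<alpha>1 \<alpha>2 :: real
  assumes "boundary_setting \<Omega> \<phi> s0 s1 s2 \<delta>"
    and "\<nu> > 0" and "\<alpha>1 > 0" and "\<alpha>2 > 0"
  shows "\<not> (\<exists>(u :: real^2 \<Rightarrow> real^2) (p :: real^2 \<Rightarrow> real).
            velocity_field \<Omega> \<phi> s0 s2 u \<and>
            parallel_laminar \<Omega> \<phi> s0 s2 u \<and>
            (\<exists>\<epsilon>>0. \<forall>x2\<in>{0<..<\<epsilon>}.
               u (vector [0, x2]) $ 1 = \<alpha>1 * x2 - \<alpha>2 / 2 * x2^2 \<and>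
               u (vector [0, x2]) $ 2 = 0) \<and>
            stationary_NS_near \<Omega> (\<phi> ` {s1..s2}) \<nu> u p)"
proof
  assume "\<exists>(u :: real^2 \<Rightarrow> real^2) (p :: real^2 \<Rightarrow> real).
            velocity_field \<Omega> \<phi> s0 s2 u \<and>
            parallel_laminar \<Omega> \<phi> s0 s2 u \<and>
            (\<exists>\<epsilon>>0. \<forall>x2\<in>{0<..<\<epsilon>}.
               u (vector [0, x2]) $ 1 = \<alpha>1 * x2 - \<alpha>2 / 2 * x2^2 \<and>
               u (vector [0, x2]) $ 2 = 0) \<and>
            stationary_NS_near \<Omega> (\<phi> ` {s1..s2}) \<nu> u p"
  then obtain u p \<epsilon> where V: "velocity_field \<Omega> \<phi> s0 s2 u" and P: "parallel_laminar \<Omega> \<phi> s0 s2 u"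
    and \<epsilon>: "\<epsilon> > 0" "\<And>y. y \<in> {0<..<\<epsilon>} \<Longrightarrow> u (vector [0, y]) $ 1 = \<alpha>1 * y - \<alpha>2 / 2 * y\<^sup>2"
    and NS: "stationary_NS_near \<Omega> (\<phi> ` {s1..s2}) \<nu> u p"
    by blast
  note D = boundary_settingD[OF assms(1)]
  obtain R1 where R1: "R1 > 0"
    "\<And>s r. s \<in> {s0..s2} \<Longrightarrow> r \<in> {0<..<R1} \<Longrightarrow> normal_coord \<phi> s r \<in> \<Omega>"
    "\<And>s r. s \<in> {s0..<s2} \<Longrightarrow> r \<in> {0<..<R1} \<Longrightarrow>
       u (normal_coord \<phi> s r) = (u (vector [0, r]) $ 1) *\<^sub>R tangent \<phi> s"
    using parallel_laminar_speed[OF assms(1) V P] by blast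
  obtain N where N: "open N" "\<phi> ` {0..s2} \<subseteq> N"
      "\<And>x. x \<in> \<Omega> \<inter> N \<Longrightarrow> p differentiable (at x) \<and> - \<nu> *\<^sub>R laplacian u x + convection u x = - grad p x"
    using NS unfolding stationary_NS_near_def D(5) by blast
  have "continuous_on {0..s2} \<phi>"
    by (auto simp: continuous_on_eq_continuous_within
        intro!: continuous_at_imp_continuous_within has_vector_derivative_continuous[OF smooth_curve_tangent[OF D(1)]])
  then have "compact (\<phi> ` {0..s2})" by (rule compact_continuous_image) simp
  \<comment> \<open>By compactness of the arc, a strip of uniform width lies in the open set where
    the equations hold.\<close>
  then obtain e where e: "e > 0" "(\<Union>x\<in>\<phi> ` {0..s2}. ball x e) \<subseteq> N"
    using compact_subset_open_imp_ball_epsilon_subset N(1,2) by blast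
  define R where "R = min (min R1 \<epsilon>) e"
  have R: "R > 0" using R1(1) \<epsilon>(1) e(1) by (simp add: R_def)
  have inN: "normal_coord \<phi> s r \<in> \<Omega> \<inter> N" if "s \<in> {0<..<s2}" "r \<in> {0<..<R}" for s r
  proof -
    have "dist (\<phi> s) (normal_coord \<phi> s r) < e"
      using that by (simp add: dist_norm normal_coord_def D(2) R_def)
    then have "normal_coord \<phi> s r \<in> N" using e(2) that by fastforce
    then show ?thesis using R1(2)[of s r] that D(4) by (simp add: R_def)
  qed
  have u: "u (normal_coord \<phi> s r) = (\<alpha>1 * r - \<alpha>2 / 2 * r\<^sup>2) *\<^sub>R tangent \<phi> s"
    if "s \<in> {0<..<s2}" "r \<in> {0<..<R}" for s r
    using R1(3)[of s r] \<epsilon>(2)[of r] that D(4) by (simp add: R_def)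
  define C where "C = - (\<alpha>1 * \<delta> + \<alpha>2 * \<delta>\<^sup>2 / 2)"
  define h where "h = (\<lambda>r. - \<nu> / \<delta> * (3 * \<alpha>2 / 2 * (\<delta> + r) + C / (\<delta> + r)))"
  define k where "k = (\<lambda>r. (\<alpha>1 * r - \<alpha>2 / 2 * r\<^sup>2)\<^sup>2 / (\<delta> + r))"
  define q where "q = (\<lambda>s r. p (normal_coord \<phi> s r))"
  have qs: "((\<lambda>s. q s r) has_real_derivative h r) (at s)"
    and qr: "(q s has_real_derivative k r) (at r)"
    if s: "s \<in> {0<..<s2}" and r: "r \<in> {0<..<R}" for s r
  proof -
    note x = N(3)[OF inN[OF s r]]
    note gp = parallel_laminar_arc_pressure_gradient[OF assms(1) u x[THEN conjunct2] s r, folded C_def]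
    note dp = has_derivative_grad[OF x[THEN conjunct1]]
    have "h r = (1 + r / \<delta>) * (grad p (normal_coord \<phi> s r) \<bullet> tangent \<phi> s)"
      using gp(1) by (simp only: h_def)
    with has_derivative_compose[OF normal_coord_deriv_fst[OF D(1,2), unfolded has_vector_derivative_def] dp]
    show "((\<lambda>s. q s r) has_real_derivative h r) (at s)"
      using s by (simp add: q_def D(11) has_field_derivative_def mult.assoc mult_commute_abs)
    from has_derivative_compose[OF normal_coord_deriv_snd[unfolded has_vector_derivative_def] dp] gp(2)
    show "(q s has_real_derivative k r) (at r)"
      by (simp add: q_def k_def has_field_derivative_def mult_commute_abs)
  qed
  define a b where "a = s2 / 3" and "b = 2 * s2 / 3"
  have ab: "a < b" "a \<in> {0<..<s2}" "b \<in> {0<..<s2}" using D(6) by (auto simp: a_def b_def)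
  \<comment> \<open>The derivative of \<open>q\<close> in \<open>s\<close> is \<open>h r\<close>,
    independent of \<open>s\<close>, so the increment is exactly linear.\<close>
  have diff: "q b r - q a r = (b - a) * h r" if "r \<in> {0<..<R}" for r
    using MVT2[OF ab(1), of "\<lambda>s. q s r" "\<lambda>_. h r"] qs that ab by fastforce
  have h': "3 * \<alpha>2 / 2 = C / (\<delta> + r)\<^sup>2" if r: "r \<in> {0<..<R}" for r
  proof -
    \<comment> \<open>The normal derivative \<open>k r\<close> is the same at both parameters and
      cancels; hence \<open>h\<close> has zero derivative.\<close>
    have "((\<lambda>r. q b r - q a r) has_real_derivative k r - k r) (at r)"
      using ab r by (intro DERIV_diff qr)
    then have "((\<lambda>r. (b - a) * h r) has_real_derivative 0) (at r)"
      using r by (auto intro: has_field_derivative_transform_within_open[where S = "{0<..<R}"] simp: diff)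
    moreover have "((\<lambda>r. (b - a) * h r) has_real_derivative
        (b - a) * (- \<nu> / \<delta> * (3 * \<alpha>2 / 2 - C / (\<delta> + r)\<^sup>2))) (at r)"
      unfolding h_def using r D(7)
      by (auto intro!: derivative_eq_intros simp: power2_eq_square)
    ultimately have "(b - a) * (- \<nu> / \<delta> * (3 * \<alpha>2 / 2 - C / (\<delta> + r)\<^sup>2)) = 0"
      using DERIV_unique by blast
    then show ?thesis using ab assms(2) D(7) by simp
  qed
  \<comment> \<open>Any height in the strip would do; \<open>R / 2\<close> is one. Positivity of
    \<open>\<alpha>2\<close> makes the quotient positive, against \<open>C < 0\<close>.\<close>
  have "C / (\<delta> + R / 2)\<^sup>2 > 0"
    using R assms(4) by (subst h'[symmetric]) auto
  moreover have "\<alpha>1 * \<delta> > 0" "\<alpha>2 * \<delta>\<^sup>2 / 2 > 0" using assms(3,4) D(7) by simp_all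
  then have "C < 0" unfolding C_def by linarith
  ultimately show False by (simp add: zero_less_divide_iff)
qed

end
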